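(* Given an alternating pushdown tree automaton $\mathcal{A}$ on $(AP,X\times Y)$-trees, one can build an alternating pushdown tree automaton $\mathcal{A}_{\Downarrow X}$ on $(AP,X)$-trees such that for every pointed $(AP,X)$-tree $(T,u)$, every $u'\in(X\times Y)^+$ whose projection on $X$ is $u$, and every initial stack content $w_\iota\in\Gamma^*\cdot\bot$, $(T,u)\in L(\mathcal{A}_{\Downarrow X},w_\iota)$ if and only if $(T^{\Uparrow X\times Y},u')\in L(\mathcal{A},w_\iota)$, where $T^{\Uparrow X\times Y}$ denotes the $Y$-widening of $T$ rooted in the first letter of $u'$.
   Context: Trees: for a set $D$, a $D$-tree is a set $\tau\subseteq D^+$ of words with a common first letter (root), closed under nonempty prefixes, in which every node has a child; an $(AP,D)$-tree is $(\tau,\ell)$ with $\ell:\tau\to2^{AP}$; automata inputs are complete trees; a pointed tree is a tree with a node. The projection on $X$ of $(x,y)\in X\times Y$ is $x$, extended letterwise to words. Widening: for an $X$-tree $\tau$ with root $x$ and $y\in Y$, the $Y$-widening of $\tau$ rooted in $(x,y)$ is $\{v\in(x,y)\cdot(X\times Y)^*: \text{the projection of }v\text{ on }X\text{ is in }\tau\}$; for $T=(\tau,\ell)$ it is labelled by $\ell'(v)=\ell(\text{projection of }v\text{ on }X)$. An alternating pushdown tree automaton (APTA) on $(AP,D)$-trees is $(\Gamma,Q,\delta,q_\iota,C)$: $\Gamma$ finite stack alphabet with bottom $\bot$, $Q$ finite, $q_\iota\in Q$, $\delta:Q\times2^{AP}\times\Gamma\to B^+(D\times Q\times\Gamma^*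 )$ (positive Boolean formulas with constants $\mathit{true},\mathit{false}$ over atoms $[x,q',w']$), never removing or pushing $\bot$, colouring $C:Q\to\mathbb{N}$. Acceptance of $(T,u)$ with initial stack $w_\iota$ (top on the left): parity game with positions $(v,q,w,\beta)$, start $(u,q_\iota,w_\iota,\delta(q_\iota,\ell(u),\mathrm{top}(w_\iota)))$; Eve resolves $\vee$, Adam resolves $\wedge$; atom $[x,q',w']$ at $(v,q,\gamma w,\cdot)$ moves to $(vx,q',w'w,\delta(q',\ell(vx),\mathrm{top}(w'w)))$; $\mathit{true}$/$\mathit{false}$ win for Eve/Adam; Eve wins infinite plays whose largest colour $C(q)$ seen infinitely often is even; $L(\mathcal{A},w_\iota)$ is the set of pointed trees where Eve wins. *)

theory Defs
  imports "HOL-Library.Infinite_Set"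
begin

text \<open>
  Words are lists. A labelled tree is a pair of a set of nodes and a labelling; the labelling is a
  total HOL function whose values outside the set of nodes are irrelevant.
\<close>

type_synonym ('ap, 'd) labelled_tree = "'d list set \<times> ('d list \<Rightarrow> 'ap set)"

definition words1 :: "'d set \<Rightarrow> 'd list set" where
  "words1 D = lists D - {[]}"

text \<open>A tree has a root, hence it is nonempty.\<close>

definition is_tree :: "'d set \<Rightarrow> 'd list set \<Rightarrow> bool" where
  "is_tree D \<tau> \<longleftrightarrow>
     \<tau> \<subseteq> words1 D \<and>
     (\<exists>r. [r] \<in> \<tau> \<and> (\<forall>v\<in>\<tau>. hd v = r)) \<and>
     (\<forall>v v'. v @ v' \<in> \<tau> \<and> v \<noteq> [] \<longrightarrow> v \<in> \<tau>) \<and>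
     (\<forall>v\<in>\<tau>. \<exists>x\<in>D. v @ [x] \<in> \<tau>)"

definition is_complete :: "'d set \<Rightarrow> 'd list set \<Rightarrow> bool" where
  "is_complete D \<tau> \<longleftrightarrow> (\<forall>v\<in>\<tau>. \<forall>x\<in>D. v @ [x] \<in> \<tau>)"

definition is_labelled_tree :: "'ap set \<Rightarrow> 'd set \<Rightarrow> ('ap, 'd) labelled_tree \<Rightarrow> bool" where
  "is_labelled_tree AP D T \<longleftrightarrow> is_tree D (fst T) \<and> (\<forall>v\<in>fst T. snd T v \<subseteq> AP)"

definition pointed_trees ::
  "'ap set \<Rightarrow> 'd set \<Rightarrow> (('ap, 'd) labelled_tree \<times> 'd list) set" where
  "pointed_trees AP D = {(T, u). is_labelled_tree AP D T \<and> u \<in> fst T}"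

definition proj_word :: "('x \<times> 'y) list \<Rightarrow> 'x list" where
  "proj_word = map fst"

definition widening ::
  "'x set \<Rightarrow> 'y set \<Rightarrow> 'x \<times> 'y \<Rightarrow> ('ap, 'x) labelled_tree \<Rightarrow> ('ap, 'x \<times> 'y) labelled_tree" where
  "widening X Y r T =
     ({r # v |v. v \<in> lists (X \<times> Y) \<and> proj_word (r # v) \<in> fst T}, \<lambda>v. snd T (proj_word v))"

datatype (atoms: 'a) pbf = Tru | Fls | Atm 'a | Conj "'a pbf" "'a pbf" | Disj "'a pbf" "'a pbf"

text \<open>
  The set of directions \<open>D\<close> and of atomic propositions \<open>AP\<close> are parameters of well-formedness
  rather than components. The bottom symbol belongs to the stack alphabet.
\<close>

record ('ap, 'd, 'q, 'g) apta =
  stack_alphabet :: "'g set"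
  bottom :: 'g
  states :: "'q set"
  delta :: "'q \<Rightarrow> 'ap set \<Rightarrow> 'g \<Rightarrow> ('d \<times> 'q \<times> 'g list) pbf"
  initial :: 'q
  colour :: "'q \<Rightarrow> nat"

text \<open>
  An atom \<open>(x, q', w')\<close> replaces the top symbol by \<open>w'\<close> (top on the left). So \<open>bottom\<close> is
  never removed or pushed iff \<open>w'\<close> ends in its only occurrence of \<open>bottom\<close> when the top symbol is
  \<open>bottom\<close>, and \<open>w'\<close> has no occurrence of it otherwise.
\<close>

definition is_apta :: "'ap set \<Rightarrow> 'd set \<Rightarrow> ('ap, 'd, 'q, 'g) apta \<Rightarrow> bool" where
  "is_apta AP D A \<longleftrightarrow>
     finite (stack_alphabet A) \<and> bottom A \<in> stack_alphabet A \<and>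
     finite (states A) \<and> initial A \<in> states A \<and>
     (\<forall>q\<in>states A. \<forall>a\<in>Pow AP. \<forall>\<gamma>\<in>stack_alphabet A. \<forall>(x, q', w') \<in> atoms (delta A q a \<gamma>).
        x \<in> D \<and> q' \<in> states A \<and>
        (if \<gamma> = bottom A
         then \<exists>w \<in> lists (stack_alphabet A - {bottom A}). w' = w @ [bottom A]
         else w' \<in> lists (stack_alphabet A - {bottom A})))"

definition stack_contents :: "('ap, 'd, 'q, 'g) apta \<Rightarrow> 'g list set" where
  "stack_contents A = {w @ [bottom A] |w. w \<in> lists (stack_alphabet A)}"

type_synonym ('d, 'q, 'g) position = "'d list \<times> 'q \<times> 'g list \<times> ('d \<times> 'q \<times> 'g list) pbf"

fun pos_state :: "('d, 'q, 'g) position \<Rightarrow> 'q" where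
  "pos_state (v, q, w, \<beta>) = q"

fun pos_formula :: "('d, 'q, 'g) position \<Rightarrow> ('d \<times> 'q \<times> 'g list) pbf" where
  "pos_formula (v, q, w, \<beta>) = \<beta>"

definition make_position ::
  "('ap, 'd, 'q, 'g) apta \<Rightarrow> ('d list \<Rightarrow> 'ap set) \<Rightarrow> 'd list \<Rightarrow> 'q \<Rightarrow> 'g list
     \<Rightarrow> ('d, 'q, 'g) position" where
  "make_position A l v q w = (v, q, w, delta A q (l v) (hd w))"

inductive move ::
  "('ap, 'd, 'q, 'g) apta \<Rightarrow> ('d list \<Rightarrow> 'ap set)
     \<Rightarrow> ('d, 'q, 'g) position \<Rightarrow> ('d, 'q, 'g) position \<Rightarrow> bool"
  for A l where
  "move A l (v, q, w, Conj \<beta>1 \<beta>2) (v, q, w, \<beta>1)"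
| "move A l (v, q, w, Conj \<beta>1 \<beta>2) (v, q, w, \<beta>2)"
| "move A l (v, q, w, Disj \<beta>1 \<beta>2) (v, q, w, \<beta>1)"
| "move A l (v, q, w, Disj \<beta>1 \<beta>2) (v, q, w, \<beta>2)"
| "move A l (v, q, \<gamma> # w, Atm (x, q', w')) (make_position A l (v @ [x]) q' (w' @ w))"

definition eve_position :: "('d, 'q, 'g) position \<Rightarrow> bool" where
  "eve_position p \<longleftrightarrow> (\<exists>\<beta>1 \<beta>2. pos_formula p = Disj \<beta>1 \<beta>2)"

text \<open>Strategies may depend on the whole history of the play (current position last).\<close>

definition eve_strategy ::
  "('ap, 'd, 'q, 'g) apta \<Rightarrow> ('d list \<Rightarrow> 'ap set)
     \<Rightarrow> (('d, 'q, 'g) position list \<Rightarrow> ('d, 'q, 'g) position) \<Rightarrow> bool" where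
  "eve_strategy A l \<sigma> \<longleftrightarrow>
     (\<forall>h. h \<noteq> [] \<and> eve_position (last h) \<longrightarrow> move A l (last h) (\<sigma> h))"

text \<open>\<open>\<rho> 0, \<dots>, \<rho> n\<close> is a play prefix from \<open>p\<close> in which Eve follows \<open>\<sigma>\<close>.\<close>

definition conforms ::
  "('ap, 'd, 'q, 'g) apta \<Rightarrow> ('d list \<Rightarrow> 'ap set)
     \<Rightarrow> (('d, 'q, 'g) position list \<Rightarrow> ('d, 'q, 'g) position)
     \<Rightarrow> ('d, 'q, 'g) position \<Rightarrow> (nat \<Rightarrow> ('d, 'q, 'g) position) \<Rightarrow> nat \<Rightarrow> bool" where
  "conforms A l \<sigma> p \<rho> n \<longleftrightarrow>
     \<rho> 0 = p \<and>
     (\<forall>i<n. move A l (\<rho> i) (\<rho> (Suc i)) \<and>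
            (eve_position (\<rho> i) \<longrightarrow> \<rho> (Suc i) = \<sigma> (map \<rho> [0..<Suc i])))"

text \<open>
  The maximum is over a finite nonempty set, as plays of a well-formed automaton visit finitely many
  states.
\<close>

definition parity_won :: "('ap, 'd, 'q, 'g) apta \<Rightarrow> (nat \<Rightarrow> ('d, 'q, 'g) position) \<Rightarrow> bool" where
  "parity_won A \<rho> \<longleftrightarrow> even (Max {c. \<exists>\<^sub>\<infinity>i. colour A (pos_state (\<rho> i)) = c})"

text \<open>
  The maximal finite plays are those that reach \<open>Tru\<close> or \<open>Fls\<close> (the stack is never empty),
  and Eve loses exactly the latter.
\<close>

definition eve_wins ::
  "('ap, 'd, 'q, 'g) apta \<Rightarrow> ('d list \<Rightarrow> 'ap set) \<Rightarrow> ('d, 'q, 'g) position \<Rightarrow> bool" where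
  "eve_wins A l p \<longleftrightarrow>
     (\<exists>\<sigma>. eve_strategy A l \<sigma> \<and>
        (\<forall>\<rho> n. conforms A l \<sigma> p \<rho> n \<longrightarrow> pos_formula (\<rho> n) \<noteq> Fls) \<and>
        (\<forall>\<rho>. (\<forall>n. conforms A l \<sigma> p \<rho> n) \<longrightarrow> parity_won A \<rho>))"

text \<open>Automata read complete trees only.\<close>

definition language ::
  "'ap set \<Rightarrow> 'd set \<Rightarrow> ('ap, 'd, 'q, 'g) apta \<Rightarrow> 'g list
     \<Rightarrow> (('ap, 'd) labelled_tree \<times> 'd list) set" where
  "language AP D A w =
     {(T, u) \<in> pointed_trees AP D.
        is_complete D (fst T) \<and> eve_wins A (snd T) (make_position A (snd T) u (initial A) w)}"

end

(*
  The automaton on X-trees is obtained from A by erasing the Y-component of every direction in the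
  transition formulas. As the label of a node of the widening depends only on the projection of the
  node, erasing the Y-components is a functional bisimulation from the acceptance game of A on the
  widening to the acceptance game of the new automaton. Such a map preserves and reflects winning
  for Eve: a strategy on the target is pulled back by choosing preimages of its moves, and a
  strategy on the source is pushed forward by maintaining a lift of the history.
*)
theory Submission
  imports Defs
begin

section \<open>Functional bisimulations of acceptance games\<close>

locale game_bisimulation =
  fixes A :: "('ap, 'd, 'q, 'g) apta" and l :: "'d list \<Rightarrow> 'ap set"
    and B :: "('ap, 'e, 'q, 'g) apta" and m :: "'e list \<Rightarrow> 'ap set"
    and \<pi> :: "('d, 'q, 'g) position \<Rightarrow> ('e, 'q, 'g) position"
  assumes move_forth: "move A l p q \<Longrightarrow> move B m (\<pi> p) (\<pi> q)"
    and move_back: "move B m (\<pi> p) r \<Longrightarrow> \<exists>q. move A l p q \<and> \<pi> q = r"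
    and eve_position_iff [simp]: "eve_position (\<pi> p) \<longleftrightarrow> eve_position p"
    and Fls_iff [simp]: "pos_formula (\<pi> p) = Fls \<longleftrightarrow> pos_formula p = Fls"
    and state_eq [simp]: "pos_state (\<pi> p) = pos_state p"
    and colour_eq [simp]: "colour B = colour A"
begin

lemma parity_won_iff: "parity_won B (\<pi> \<circ> \<rho>) \<longleftrightarrow> parity_won A \<rho>"
  by (simp add: parity_won_def)

lemma eve_wins_back:
  assumes "eve_wins B m (\<pi> p)"
  shows "eve_wins A l p"
proof -
  obtain \<sigma>' where strat': "eve_strategy B m \<sigma>'"
    and safe': "\<forall>\<rho> n. conforms B m \<sigma>' (\<pi> p) \<rho> n \<longrightarrow> pos_formula (\<rho> n) \<noteq> Fls"
    and par': "\<forall>\<rho>. (\<forall>n. conforms B m \<sigma>' (\<pi> p) \<rho> n) \<longrightarrow> parity_won B \<rho>"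
    using assms unfolding eve_wins_def by (elim exE conjE) (rule that)
  define \<sigma> where "\<sigma> h = (SOME q. move A l (last h) q \<and> \<pi> q = \<sigma>' (map \<pi> h))" for h
  have \<sigma>: "move A l (last h) (\<sigma> h) \<and> \<pi> (\<sigma> h) = \<sigma>' (map \<pi> h)"
    if "h \<noteq> []" "eve_position (last h)" for h
  proof -
    have "move B m (\<pi> (last h)) (\<sigma>' (map \<pi> h))"
      using strat'[unfolded eve_strategy_def, rule_format, of "map \<pi> h"] that
      by (simp add: last_map)
    then show ?thesis
      unfolding \<sigma>_def by (rule someI_ex[OF move_back])
  qed
  have conf: "conforms B m \<sigma>' (\<pi> p) (\<pi> \<circ> \<rho>) n" if "conforms A l \<sigma> p \<rho> n" for \<rho> n
    unfolding conforms_def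
  proof (intro conjI allI impI)
    show "(\<pi> \<circ> \<rho>) 0 = \<pi> p"
      using that by (simp add: conforms_def)
  next
    fix i assume "i < n"
    then show "move B m ((\<pi> \<circ> \<rho>) i) ((\<pi> \<circ> \<rho>) (Suc i))"
      using that by (simp add: conforms_def move_forth)
  next
    fix i assume "i < n" and "eve_position ((\<pi> \<circ> \<rho>) i)"
    then show "(\<pi> \<circ> \<rho>) (Suc i) = \<sigma>' (map (\<pi> \<circ> \<rho>) [0..<Suc i])"
      using that \<sigma>[of "map \<rho> [0..<Suc i]"] by (simp add: conforms_def)
  qed
  have "eve_strategy A l \<sigma>"
    unfolding eve_strategy_def using \<sigma> by blast
  moreover have "pos_formula (\<rho> n) \<noteq> Fls" if "conforms A l \<sigma> p \<rho> n" for \<rho> n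
    using safe' conf[OF that] by fastforce
  moreover have "parity_won A \<rho>" if "\<forall>n. conforms A l \<sigma> p \<rho> n" for \<rho>
    using par' conf that parity_won_iff by blast
  ultimately show ?thesis
    unfolding eve_wins_def by blast
qed

lemma eve_wins_forth:
  assumes "eve_wins A l p"
  shows "eve_wins B m (\<pi> p)"
proof -
  obtain \<sigma> where strat: "eve_strategy A l \<sigma>"
    and safe: "\<forall>\<rho> n. conforms A l \<sigma> p \<rho> n \<longrightarrow> pos_formula (\<rho> n) \<noteq> Fls"
    and par: "\<forall>\<rho>. (\<forall>n. conforms A l \<sigma> p \<rho> n) \<longrightarrow> parity_won A \<rho>"
    using assms unfolding eve_wins_def by blast
  define lift_step where "lift_step h r =
    (if h = [] then p
     else if eve_position (last h) \<and> \<pi> (\<sigma> h) = r then \<sigma> h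
     else (SOME q. move A l (last h) q \<and> \<pi> q = r))" for h r
  define lift where "lift = foldl (\<lambda>h r. h @ [lift_step h r]) []"
  have lift_Nil: "lift [] = []"
    and lift_snoc: "lift (h @ [r]) = lift h @ [lift_step (lift h) r]" for h r
    by (simp_all add: lift_def)
  \<comment> \<open>Outside the histories of actual plays the projected move may be illegal; any move will do there.\<close>
  define \<sigma>' where "\<sigma>' h =
    (if move B m (last h) (\<pi> (\<sigma> (lift h))) then \<pi> (\<sigma> (lift h))
     else (SOME r. move B m (last h) r))" for h
  have "move B m s (SOME r. move B m s r)" if eve: "eve_position s" for s
  proof -
    obtain v q w \<beta>1 \<beta>2 where "s = (v, q, w, Disj \<beta>1 \<beta>2)"
      using eve by (cases s) (auto simp: eve_position_def)
    then have "move B m s (v, q, w, \<beta>1)"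
      by (simp add: move.intros)
    then show ?thesis
      by (rule someI)
  qed
  then have strat': "eve_strategy B m \<sigma>'"
    by (simp add: eve_strategy_def \<sigma>'_def)
  define lift_play where "lift_play \<rho> i = last (lift (map \<rho> [0..<Suc i]))" for \<rho> i
  have hist: "lift (map \<rho> [0..<n]) = map (lift_play \<rho>) [0..<n]" for \<rho> n
    by (induction n) (simp_all add: lift_Nil lift_snoc lift_play_def)
  have play_0: "lift_play \<rho> 0 = p" for \<rho>
    using lift_snoc[of "[]"] by (simp add: lift_play_def lift_Nil lift_step_def)
  have play_Suc: "lift_play \<rho> (Suc i) = lift_step (map (lift_play \<rho>) [0..<Suc i]) (\<rho> (Suc i))"
    for \<rho> i
    using hist[of \<rho> "Suc i"] lift_snoc[of "map \<rho> [0..<Suc i]" "\<rho> (Suc i)"]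
    by (simp add: lift_play_def)
  have conf: "conforms A l \<sigma> p (lift_play \<rho>) n \<and> \<pi> (lift_play \<rho> n) = \<rho> n"
    if "conforms B m \<sigma>' (\<pi> p) \<rho> n" for \<rho> n
    using that
  proof (induction n)
    case 0
    then show ?case by (simp add: conforms_def play_0)
  next
    case (Suc n)
    let ?h = "map (lift_play \<rho>) [0..<Suc n]"
    have IH: "conforms A l \<sigma> p (lift_play \<rho>) n" "\<pi> (lift_play \<rho> n) = \<rho> n"
      using Suc by (simp_all add: conforms_def)
    have mv: "move B m (\<pi> (lift_play \<rho> n)) (\<rho> (Suc n))"
      using Suc.prems IH(2) by (simp add: conforms_def)
    have "move A l (lift_play \<rho> n) (lift_play \<rho> (Suc n)) \<and> \<pi> (lift_play \<rho> (Suc n)) = \<rho> (Suc n)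
      \<and> (eve_position (lift_play \<rho> n) \<longrightarrow> lift_play \<rho> (Suc n) = \<sigma> ?h)"
    proof (cases "eve_position (lift_play \<rho> n)")
      case True
      then have "move A l (lift_play \<rho> n) (\<sigma> ?h)"
        using strat[unfolded eve_strategy_def, rule_format, of ?h] by simp
      moreover from this have "\<sigma>' (map \<rho> [0..<Suc n]) = \<pi> (\<sigma> ?h)"
        using move_forth IH(2) hist[of \<rho> "Suc n"] by (fastforce simp: \<sigma>'_def)
      then have "\<rho> (Suc n) = \<pi> (\<sigma> ?h)"
        using Suc.prems True IH(2) eve_position_iff[of "lift_play \<rho> n"]
        by (simp add: conforms_def)
      moreover from this True have "lift_play \<rho> (Suc n) = \<sigma> ?h"
        by (simp add: play_Suc lift_step_def)
      ultimately show ?thesis by simp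
    next
      case False
      then have "lift_play \<rho> (Suc n) =
          (SOME q. move A l (lift_play \<rho> n) q \<and> \<pi> q = \<rho> (Suc n))"
        by (simp add: play_Suc lift_step_def)
      then show ?thesis
        using someI_ex[OF move_back[OF mv]] False by simp
    qed
    then show ?case
      using IH(1) by (auto simp: conforms_def less_Suc_eq)
  qed
  have "pos_formula (\<rho> n) \<noteq> Fls" if "conforms B m \<sigma>' (\<pi> p) \<rho> n" for \<rho> n
    using safe conf[OF that] by (metis Fls_iff)
  moreover have "parity_won B \<rho>" if "\<forall>n. conforms B m \<sigma>' (\<pi> p) \<rho> n" for \<rho>
  proof -
    have "\<pi> \<circ> lift_play \<rho> = \<rho>"
      using conf that by auto
    then show ?thesis
      using par conf that parity_won_iff by metis
  qed
  ultimately show ?thesis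
    using strat' unfolding eve_wins_def by blast
qed

lemma eve_wins_iff: "eve_wins B m (\<pi> p) \<longleftrightarrow> eve_wins A l p"
  using eve_wins_back eve_wins_forth by blast

end

section \<open>Projecting the directions of an automaton\<close>

definition proj_formula :: "(('x \<times> 'y) \<times> 'q \<times> 'g list) pbf \<Rightarrow> ('x \<times> 'q \<times> 'g list) pbf" where
  "proj_formula = map_pbf (map_prod fst id)"

definition proj_apta :: "('ap, 'x \<times> 'y, 'q, 'g) apta \<Rightarrow> ('ap, 'x, 'q, 'g) apta" where
  "proj_apta A =
     \<lparr>stack_alphabet = stack_alphabet A, bottom = bottom A, states = states A,
      delta = (\<lambda>q a \<gamma>. proj_formula (delta A q a \<gamma>)), initial = initial A, colour = colour A\<rparr>"

fun proj_position :: "('x \<times> 'y, 'q, 'g) position \<Rightarrow> ('x, 'q, 'g) position" where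
  "proj_position (v, q, w, \<beta>) = (proj_word v, q, w, proj_formula \<beta>)"

lemma proj_formula_simps [simp]:
  "proj_formula Tru = Tru"
  "proj_formula Fls = Fls"
  "proj_formula (Atm (d, q, w)) = Atm (fst d, q, w)"
  "proj_formula (Conj \<beta>1 \<beta>2) = Conj (proj_formula \<beta>1) (proj_formula \<beta>2)"
  "proj_formula (Disj \<beta>1 \<beta>2) = Disj (proj_formula \<beta>1) (proj_formula \<beta>2)"
  by (simp_all add: proj_formula_def)

lemma proj_apta_simps [simp]:
  "stack_alphabet (proj_apta A) = stack_alphabet A"
  "bottom (proj_apta A) = bottom A"
  "states (proj_apta A) = states A"
  "delta (proj_apta A) q a \<gamma> = proj_formula (delta A q a \<gamma>)"
  "initial (proj_apta A) = initial A"
  "colour (proj_apta A) = colour A"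
  by (simp_all add: proj_apta_def)

lemma atoms_proj_formula: "atoms (proj_formula \<beta>) = map_prod fst id ` atoms \<beta>"
  by (simp add: proj_formula_def pbf.set_map)

lemma is_apta_proj_apta:
  assumes "is_apta AP (X \<times> Y) A"
  shows "is_apta AP X (proj_apta A)"
proof -
  let ?ok = "\<lambda>D \<gamma> (x, q', w'). x \<in> D \<and> q' \<in> states A \<and>
    (if \<gamma> = bottom A
     then \<exists>w \<in> lists (stack_alphabet A - {bottom A}). w' = w @ [bottom A]
     else w' \<in> lists (stack_alphabet A - {bottom A}))"
  have ok: "?ok X \<gamma> (map_prod fst id t)" if "?ok (X \<times> Y) \<gamma> t" for \<gamma> t
    using that by (cases t) (simp add: mem_Times_iff)
  have A: "\<forall>q\<in>states A. \<forall>a\<in>Pow AP. \<forall>\<gamma>\<in>stack_alphabet A.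
      \<forall>t\<in>atoms (delta A q a \<gamma>). ?ok (X \<times> Y) \<gamma> t"
    using assms unfolding is_apta_def by (elim conjE)
  have "\<forall>q\<in>states A. \<forall>a\<in>Pow AP. \<forall>\<gamma>\<in>stack_alphabet A.
      \<forall>t\<in>atoms (proj_formula (delta A q a \<gamma>)). ?ok X \<gamma> t"
    unfolding atoms_proj_formula ball_simps(9)
    by (intro ballI) (rule ok, rule A[rule_format])
  then show ?thesis
    using assms unfolding is_apta_def proj_apta_simps by (elim conjE) (intro conjI)
qed

lemma proj_position_make_position:
  "proj_position (make_position A (\<lambda>v. l (proj_word v)) v q w)
   = make_position (proj_apta A) l (proj_word v) q w"
  by (simp add: make_position_def)

lemma move_proj_forth:
  assumes "move A (\<lambda>v. l (proj_word v)) p q"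
  shows "move (proj_apta A) l (proj_position p) (proj_position q)"
  using assms
proof cases
  case (5 v q \<gamma> w x q' w')
  then show ?thesis
    using move.intros(5)[of "proj_apta A" l "proj_word v" q \<gamma> w "fst x" q' w']
    by (simp add: proj_position_make_position) (simp add: proj_word_def)
qed (auto intro: move.intros)

lemma move_proj_back:
  assumes "move (proj_apta A) l (proj_position p) r"
  shows "\<exists>q. move A (\<lambda>v. l (proj_word v)) p q \<and> proj_position q = r"
proof -
  obtain v s w \<beta> where p: "p = (v, s, w, \<beta>)"
    by (cases p)
  show ?thesis
  proof (cases \<beta>)
    case (Atm a)
    obtain d s' w' where a: "a = (d, s', w')"
      by (cases a)
    from assms obtain \<gamma> w0 where w: "w = \<gamma> # w0"
      and r: "r = make_position (proj_apta A) l (proj_word v @ [fst d]) s' (w' @ w0)"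
      by (auto simp: p Atm a elim: move.cases)
    let ?q = "make_position A (\<lambda>v. l (proj_word v)) (v @ [d]) s' (w' @ w0)"
    have "move A (\<lambda>v. l (proj_word v)) p ?q"
      unfolding p Atm a w by (rule move.intros)
    moreover have "proj_position ?q = r"
      unfolding r proj_position_make_position by (simp add: proj_word_def)
    ultimately show ?thesis by blast
  next
    case (Conj \<beta>1 \<beta>2)
    then show ?thesis
      using assms unfolding p by (fastforce elim: move.cases intro: move.intros)
  next
    case (Disj \<beta>1 \<beta>2)
    then show ?thesis
      using assms unfolding p by (fastforce elim: move.cases intro: move.intros)
  qed (use assms in \<open>auto simp: p elim: move.cases\<close>)
qed

lemma game_bisimulation_proj:
  "game_bisimulation A (\<lambda>v. l (proj_word v)) (proj_apta A) l proj_position"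
proof
  fix p :: "('b \<times> 'c, 'd, 'e) position"
  obtain v q w \<beta> where p: "p = (v, q, w, \<beta>)"
    by (cases p)
  show "eve_position (proj_position p) \<longleftrightarrow> eve_position p"
    by (cases \<beta>) (auto simp: p eve_position_def)
  show "pos_formula (proj_position p) = Fls \<longleftrightarrow> pos_formula p = Fls"
    by (cases \<beta>) (auto simp: p)
  show "pos_state (proj_position p) = pos_state p"
    by (simp add: p)
qed (simp_all add: move_proj_forth move_proj_back del: split_paired_Ex)

lemma eve_wins_proj_apta:
  "eve_wins (proj_apta A) l (make_position (proj_apta A) l (proj_word v) q w)
   \<longleftrightarrow> eve_wins A (\<lambda>v. l (proj_word v)) (make_position A (\<lambda>v. l (proj_word v)) v q w)"
  using game_bisimulation.eve_wins_iff[OF game_bisimulation_proj]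
  by (metis proj_position_make_position)

section \<open>Widenings\<close>

lemma mem_widening_iff:
  "v \<in> fst (widening X Y r T) \<longleftrightarrow>
     v \<noteq> [] \<and> hd v = r \<and> tl v \<in> lists (X \<times> Y) \<and> proj_word v \<in> fst T"
  by (cases v) (auto simp: widening_def)

lemma snd_widening [simp]: "snd (widening X Y r T) = (\<lambda>v. snd T (proj_word v))"
  by (simp add: widening_def)

lemma snoc_mem_widening:
  assumes "v \<in> fst (widening X Y r T)" "d \<in> X \<times> Y" "proj_word v @ [fst d] \<in> fst T"
  shows "v @ [d] \<in> fst (widening X Y r T)"
  using assms by (auto simp: mem_widening_iff proj_word_def)

lemma is_labelled_tree_widening:
  assumes T: "is_labelled_tree AP X T" and r: "r \<in> X \<times> Y" "[fst r] \<in> fst T"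
  shows "is_labelled_tree AP (X \<times> Y) (widening X Y r T)"
proof -
  let ?W = "fst (widening X Y r T)"
  have tree: "is_tree X (fst T)"
    using T by (simp add: is_labelled_tree_def)
  have "?W \<subseteq> words1 (X \<times> Y)"
  proof
    fix v assume "v \<in> ?W"
    then show "v \<in> words1 (X \<times> Y)"
      using r(1) by (cases v) (auto simp: mem_widening_iff words1_def)
  qed
  moreover have "[r] \<in> ?W" "\<forall>v\<in>?W. hd v = r"
    using r(2) by (auto simp: mem_widening_iff proj_word_def)
  moreover have "v \<in> ?W" if "v @ v' \<in> ?W" "v \<noteq> []" for v v'
  proof -
    have "proj_word v @ proj_word v' \<in> fst T" "proj_word v \<noteq> []"
      using that by (auto simp: mem_widening_iff proj_word_def)
    moreover have "\<forall>v v'. v @ v' \<in> fst T \<and> v \<noteq> [] \<longrightarrow> v \<in> fst T"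
      using tree unfolding is_tree_def by (elim conjE)
    ultimately have "proj_word v \<in> fst T"
      by blast
    then show ?thesis
      using that by (auto simp: mem_widening_iff)
  qed
  moreover have "\<exists>d\<in>X \<times> Y. v @ [d] \<in> ?W" if "v \<in> ?W" for v
  proof -
    have "\<forall>v\<in>fst T. \<exists>x\<in>X. v @ [x] \<in> fst T"
      using tree unfolding is_tree_def by (elim conjE)
    moreover have "proj_word v \<in> fst T"
      using that by (simp add: mem_widening_iff)
    ultimately obtain x where "x \<in> X" "proj_word v @ [x] \<in> fst T"
      by blast
    then have "(x, snd r) \<in> X \<times> Y" "v @ [(x, snd r)] \<in> ?W"
      using that r(1) by (auto intro!: snoc_mem_widening)
    then show ?thesis by blast
  qed
  ultimately have "is_tree (X \<times> Y) ?W"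
    unfolding is_tree_def by blast
  then show ?thesis
    using T by (auto simp: is_labelled_tree_def mem_widening_iff)
qed

lemma is_complete_widening_iff:
  assumes tree: "is_tree X (fst T)" and r: "r \<in> X \<times> Y" "[fst r] \<in> fst T"
  shows "is_complete (X \<times> Y) (fst (widening X Y r T)) \<longleftrightarrow> is_complete X (fst T)"
proof
  assume "is_complete X (fst T)"
  then show "is_complete (X \<times> Y) (fst (widening X Y r T))"
    unfolding is_complete_def
    by (metis mem_Times_iff mem_widening_iff snoc_mem_widening)
next
  assume complete: "is_complete (X \<times> Y) (fst (widening X Y r T))"
  show "is_complete X (fst T)"
    unfolding is_complete_def
  proof (intro ballI)
    fix v x assume v: "v \<in> fst T" and x: "x \<in> X"
    let ?v = "map (\<lambda>x. (x, snd r)) v"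
    have proj: "proj_word ?v = v"
      by (simp add: proj_word_def comp_def)
    have "v \<in> words1 X" "hd v = fst r"
      using tree v r(2) unfolding is_tree_def by (blast, metis list.sel(1))
    then have "?v \<in> fst (widening X Y r T)"
      using v r(1) proj
      by (cases v) (auto simp: mem_widening_iff words1_def)
    moreover have "(x, snd r) \<in> X \<times> Y"
      using x r(1) by auto
    ultimately have "?v @ [(x, snd r)] \<in> fst (widening X Y r T)"
      using complete unfolding is_complete_def by blast
    then show "v @ [x] \<in> fst T"
      using proj by (simp add: mem_widening_iff) (simp add: proj_word_def)
  qed
qed

lemma language_proj_apta_iff:
  assumes T: "(T, proj_word v) \<in> pointed_trees AP X" and v: "v \<in> words1 (X \<times> Y)"
  shows "(T, proj_word v) \<in> language AP X (proj_apta A) w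
         \<longleftrightarrow> (widening X Y (hd v) T, v) \<in> language AP (X \<times> Y) A w"
proof -
  obtain r v0 where v_eq: "v = r # v0" and r: "r \<in> X \<times> Y" and v0: "v0 \<in> lists (X \<times> Y)"
    using v by (cases v) (auto simp: words1_def)
  have lab: "is_labelled_tree AP X T" and u: "proj_word v \<in> fst T"
    using T by (auto simp: pointed_trees_def)
  then have tree: "is_tree X (fst T)"
    by (simp add: is_labelled_tree_def)
  have "[fst r] @ proj_word v0 \<in> fst T"
    using u by (simp add: v_eq proj_word_def)
  then have root: "[fst r] \<in> fst T"
    using tree unfolding is_tree_def by blast
  have "(widening X Y r T, v) \<in> pointed_trees AP (X \<times> Y)"
    using is_labelled_tree_widening[OF lab r root] u v0
    by (simp add: pointed_trees_def mem_widening_iff v_eq)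
  then show ?thesis
    using T is_complete_widening_iff[OF tree r root] eve_wins_proj_apta[of A "snd T" v]
    by (simp add: language_def v_eq)
qed

theorem theorem3p5:
  fixes X :: "'x set" and Y :: "'y set" and AP :: "'ap set"
    and A :: "('ap, 'x \<times> 'y, 'q, 'g) apta"
  assumes "is_apta AP (X \<times> Y) A"
  shows "\<exists>A' :: ('ap, 'x, 'q, 'g) apta.
           is_apta AP X A' \<and>
           stack_alphabet A' = stack_alphabet A \<and> bottom A' = bottom A \<and>
           (\<forall>T u u' w. (T, u) \<in> pointed_trees AP X \<longrightarrow>
              u' \<in> words1 (X \<times> Y) \<longrightarrow> proj_word u' = u \<longrightarrow> w \<in> stack_contents A \<longrightarrow>
              ((T, u) \<in> language AP X A' w \<longleftrightarrow>
               (widening X Y (hd u') T, u') \<in> language AP (X \<times> Y) A w))"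
  using is_apta_proj_apta[OF assms]
  by (intro exI[of _ "proj_apta A"] conjI allI impI) (simp, simp, simp, metis language_proj_apta_iff)

end
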